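(* Let $N\ge3$ be an integer and $\hat\rho_2,p_{\rm eq}\in[0,1]$. Consider the two-player game in which players 1 and 2 choose $q_1,q_2\in[0,1]$ respectively, with utilities $$U_2(q_1,q_2)=q_2\left[A_N(\hat\rho_2,p_{\rm eq})q_1+B_N(\hat\rho_2,p_{\rm eq})\right]+C_N(\hat\rho_2,p_{\rm eq})q_1+D_N(\hat\rho_2,p_{\rm eq}),$$ $$U_1(q_1,q_2)=q_1\left[A_N(\hat\rho_2,p_{\rm eq})q_2+B_N(\hat\rho_2,p_{\rm eq})\right]+C_N(\hat\rho_2,p_{\rm eq})q_2+D_N(\hat\rho_2,p_{\rm eq}).$$ (This is the game as perceived by player 2, who assumes that player 1 has the same belief $\hat\rho_2$ as herself.) Then there exists a unique symmetric Nash equilibrium $q_1=q_2=q_{\rm eq}$, and it is given by $$q_{\rm eq}=\max\left(0,\min\left(1,-\frac{B_N(\hat\rho_2,p_{\rm eq})}{A_N(\hat\rho_2,p_{\rm eq})}\right)\right).$$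
   Context: For an integer $N\ge 3$, $\rho\in[0,1]$ and $p\in(0,1)$ define $$A_N(\rho,p)=\frac{\rho\left(p^N(N(p-1)-2p+1)+(1-p)^N+p\left((N-2)(1-p)^N+2\right)-1\right)+p^N(-Np+N+2p-1)-p^2}{(N-1)(p-1)^2p^2},$$ $$B_N(\rho,p)=\frac{\rho\left(p\left(p^N+(1-p)^N-1\right)-N\left((1-p)^N+p-1\right)\right)}{(N-1)(p-1)^2p}+\frac{-p^N+N(p-1)+1}{(N-1)(p-1)^2},$$ $$C_N(\rho,p)=\frac{\rho\left((-Np+N+p)p^N+p\left(-(N-1)(1-p)^N-1\right)\right)+(N(p-1)-p)p^N+p}{(N-1)(p-1)^2p},$$ $$D_N(\rho,p)=\frac{p^N-(N-1)p^2+(N-2)p}{(N-1)(p-1)^2}-\frac{\rho\left(p^N-(N-1)(1-p)^N-Np+N-1\right)}{(N-1)(p-1)^2}.$$ At $p=0$ and $p=1$ the coefficients are defined by their limits as $p\to0$, $p\to1$; in particular $A_N(\rho,0)=-\frac{N(N-3)}{2(N-1)}\rho-\frac1{N-1}$, $A_N(\rho,1)=\frac{N(N-3)}{2(N-1)}\rho-\frac N2+1$, $B_N(\rho,0)=N\rho-1$, $B_N(\rho,1)=\frac{N(N+1)}{2(N-1)}\rho-\frac N2$. A Nash equilibrium is a pair $(q_1,q_2)\in[0,1]^2$ such that neither player can increase her own utility by unilaterally changing her own strategy; it is symmetric if $q_1=q_2$. *)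

theory Defs
  imports "HOL-Analysis.Analysis"
begin

definition A_formula :: "nat \<Rightarrow> real \<Rightarrow> real \<Rightarrow> real" where
  "A_formula N \<rho> p =
     (\<rho> * (p ^ N * (real N * (p - 1) - 2 * p + 1) + (1 - p) ^ N
           + p * ((real N - 2) * (1 - p) ^ N + 2) - 1)
      + p ^ N * (- real N * p + real N + 2 * p - 1) - p ^ 2)
     / ((real N - 1) * (p - 1) ^ 2 * p ^ 2)"

definition B_formula :: "nat \<Rightarrow> real \<Rightarrow> real \<Rightarrow> real" where
  "B_formula N \<rho> p =
     (\<rho> * (p * (p ^ N + (1 - p) ^ N - 1) - real N * ((1 - p) ^ N + p - 1)))
       / ((real N - 1) * (p - 1) ^ 2 * p)
     + (- (p ^ N) + real N * (p - 1) + 1) / ((real N - 1) * (p - 1) ^ 2)"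

definition C_formula :: "nat \<Rightarrow> real \<Rightarrow> real \<Rightarrow> real" where
  "C_formula N \<rho> p =
     (\<rho> * ((- real N * p + real N + p) * p ^ N
           + p * (- (real N - 1) * (1 - p) ^ N - 1))
      + (real N * (p - 1) - p) * p ^ N + p)
     / ((real N - 1) * (p - 1) ^ 2 * p)"

definition D_formula :: "nat \<Rightarrow> real \<Rightarrow> real \<Rightarrow> real" where
  "D_formula N \<rho> p =
     (p ^ N - (real N - 1) * p ^ 2 + (real N - 2) * p) / ((real N - 1) * (p - 1) ^ 2)
     - (\<rho> * (p ^ N - (real N - 1) * (1 - p) ^ N - real N * p + real N - 1))
         / ((real N - 1) * (p - 1) ^ 2)"

text \<open>The formulas are 0/0 at \<open>p = 0\<close> or \<open>p = 1\<close> (which HOL would evaluate to 0); there the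
  coefficients are the limits taken from inside the open unit interval. Only \<open>p\<close> in the closed
  unit interval is meaningful.\<close>

definition extend_to_endpoints :: "(real \<Rightarrow> real) \<Rightarrow> real \<Rightarrow> real" where
  "extend_to_endpoints f p =
     (if p \<in> {0<..<1} then f p else Lim (at p within {0<..<1}) f)"

definition A_coeff :: "nat \<Rightarrow> real \<Rightarrow> real \<Rightarrow> real" where
  "A_coeff N \<rho> = extend_to_endpoints (A_formula N \<rho>)"

definition B_coeff :: "nat \<Rightarrow> real \<Rightarrow> real \<Rightarrow> real" where
  "B_coeff N \<rho> = extend_to_endpoints (B_formula N \<rho>)"

definition C_coeff :: "nat \<Rightarrow> real \<Rightarrow> real \<Rightarrow> real" where
  "C_coeff N \<rho> = extend_to_endpoints (C_formula N \<rho>)"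

definition D_coeff :: "nat \<Rightarrow> real \<Rightarrow> real \<Rightarrow> real" where
  "D_coeff N \<rho> = extend_to_endpoints (D_formula N \<rho>)"

definition U1 :: "nat \<Rightarrow> real \<Rightarrow> real \<Rightarrow> real \<Rightarrow> real \<Rightarrow> real" where
  "U1 N \<rho> p q1 q2 =
     q1 * (A_coeff N \<rho> p * q2 + B_coeff N \<rho> p) + C_coeff N \<rho> p * q2 + D_coeff N \<rho> p"

definition U2 :: "nat \<Rightarrow> real \<Rightarrow> real \<Rightarrow> real \<Rightarrow> real \<Rightarrow> real" where
  "U2 N \<rho> p q1 q2 =
     q2 * (A_coeff N \<rho> p * q1 + B_coeff N \<rho> p) + C_coeff N \<rho> p * q1 + D_coeff N \<rho> p"

text \<open>Both utilities take the strategy of player 1 as first and that of player 2 as second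
  argument.\<close>

definition nash_equilibrium ::
  "(real \<Rightarrow> real \<Rightarrow> real) \<Rightarrow> (real \<Rightarrow> real \<Rightarrow> real) \<Rightarrow> real \<times> real \<Rightarrow> bool" where
  "nash_equilibrium u1 u2 s \<longleftrightarrow>
     fst s \<in> {0..1} \<and> snd s \<in> {0..1} \<and>
     \<not> (\<exists>q\<in>{0..1}. u1 q (snd s) > u1 (fst s) (snd s)) \<and>
     \<not> (\<exists>q\<in>{0..1}. u2 (fst s) q > u2 (fst s) (snd s))"

definition symmetric_nash_equilibrium ::
  "(real \<Rightarrow> real \<Rightarrow> real) \<Rightarrow> (real \<Rightarrow> real \<Rightarrow> real) \<Rightarrow> real \<times> real \<Rightarrow> bool" where
  "symmetric_nash_equilibrium u1 u2 s \<longleftrightarrow> nash_equilibrium u1 u2 s \<and> fst s = snd s"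

end

theory Submission
  imports Defs
begin

text \<open>With \<open>S x = (\<Sum>k<N-2. (k + 1) * x ^ k)\<close>, the closed form of this sum shows that on the open
  unit interval \<open>A_N(\<rho>, p) = - ((1 - \<rho>) * S p + \<rho> * S (1 - p)) / (N - 1)\<close>. This is a polynomial in
  \<open>p\<close>, so it also gives the limits at the endpoints, and it is negative because \<open>S \<ge> 1\<close> on \<open>x \<ge> 0\<close>.
  Hence the slope \<open>A q + B\<close> of a player's utility against a symmetric opponent playing \<open>q\<close> is strictly
  decreasing in \<open>q\<close>, so exactly one \<open>q\<close> in the unit interval is a best response to itself: the zero
  of the slope, clipped to the interval.\<close>

text \<open>The sum is the derivative of a geometric sum. Clearing the denominator
  \<open>(1 - x)^2\<close> makes induction work with no case \<open>x = 1\<close>.\<close>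

lemma sum_Suc_times_power_eq:
  fixes x :: "'a::comm_ring_1"
  shows "(1 - x)^2 * (\<Sum>k<n. (of_nat k + 1) * x ^ k) = 1 - x ^ n * (1 + of_nat n * (1 - x))"
  by (induction n) (simp_all add: algebra_simps power2_eq_square)

lemma sum_Suc_times_power_ge_1:
  fixes x :: real
  assumes "0 \<le> x" "0 < n"
  shows "1 \<le> (\<Sum>k<n. (real k + 1) * x ^ k)"
proof -
  have "(\<Sum>k\<in>{0}. (real k + 1) * x ^ k) \<le> (\<Sum>k<n. (real k + 1) * x ^ k)"
    by (rule sum_mono2) (use assms in auto)
  then show ?thesis by simp
qed

text \<open>A continuous \<open>g\<close> carries its own limits at 0 and 1, so the 0/0 formula
  never has to be expanded there.\<close>

lemma extend_to_endpoints_eq: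
  assumes eq: "\<And>x. x \<in> {0<..<1} \<Longrightarrow> f x = g x"
    and cont: "continuous_on {0..1} g" and p: "p \<in> {0..1}"
  shows "extend_to_endpoints f p = g p"
proof (cases "p \<in> {0<..<1}")
  case True
  then show ?thesis by (simp add: extend_to_endpoints_def eq)
next
  case False
  have "(g \<longlongrightarrow> g p) (at p within {0<..<1})"
    by (rule tendsto_within_subset[where S = "{0..1}"])
      (use cont p in \<open>auto simp: continuous_on_def\<close>)
  then have "(f \<longlongrightarrow> g p) (at p within {0<..<1})"
    by (rule Lim_transform_eventually) (simp add: eventually_at_filter eq)
  \<comment> \<open>\<open>Lim\<close> is determined only if the filter is nontrivial, that is, if
    the endpoint is a limit point of the open interval.\<close>
  moreover have "p islimpt {0<..<1}"
  proof -
    from p False have "p = 0 \<or> p = 1" by auto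
    then show ?thesis by (auto simp: islimpt_greaterThanLessThan1 islimpt_greaterThanLessThan2)
  qed
  ultimately have "Lim (at p within {0<..<1}) f = g p"
    by (intro tendsto_Lim) (auto simp: trivial_limit_within)
  then show ?thesis using False by (simp only: extend_to_endpoints_def if_False)
qed

lemma A_formula_eq:
  assumes "N \<ge> 3" and p: "p \<in> {0<..<1}"
  shows "A_formula N \<rho> p =
    - ((1 - \<rho>) * (\<Sum>k<N-2. (real k + 1) * p ^ k) + \<rho> * (\<Sum>k<N-2. (real k + 1) * (1 - p) ^ k))
      / (real N - 1)"
proof -
  obtain n where N: "N = n + 2" using assms(1) that[of "N - 2"] by simp
  define S where "S x = (\<Sum>k<n. (real k + 1) * x ^ k)" for x :: real
  have S: "(1 - x)^2 * S x = 1 - x ^ n * (1 + real n * (1 - x))" for x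
    unfolding S_def by (rule sum_Suc_times_power_eq)
  \<comment> \<open>Grouping the numerator by \<open>1 - \<rho>\<close> and \<open>\<rho>\<close>
    exposes the closed forms of \<open>S p\<close> and \<open>S (1 - p)\<close>. They supply the
    missing factors \<open>(1 - p)^2\<close> and \<open>p^2\<close>, so the denominator
    cancels.\<close>
  have "\<rho> * (p ^ N * (real N * (p - 1) - 2 * p + 1) + (1 - p) ^ N
           + p * ((real N - 2) * (1 - p) ^ N + 2) - 1)
      + p ^ N * (- real N * p + real N + 2 * p - 1) - p ^ 2
    = - (1 - \<rho>) * p^2 * (1 - p ^ n * (1 + real n * (1 - p)))
      - \<rho> * (1 - p)^2 * (1 - (1 - p) ^ n * (1 + real n * (1 - (1 - p))))"
    unfolding N by (simp add: power_add) (simp add: algebra_simps power2_eq_square)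
  also have "\<dots> = - ((1 - \<rho>) * S p + \<rho> * S (1 - p)) * ((p - 1)^2 * p^2)"
    unfolding S[symmetric] by (simp add: algebra_simps power2_eq_square)
  finally show ?thesis
    using p by (simp add: A_formula_def N S_def)
qed

lemma A_coeff_neg:
  assumes "N \<ge> 3" "\<rho> \<in> {0..1}" "p \<in> {0..1}"
  shows "A_coeff N \<rho> p < 0"
proof -
  define S where "S x = (\<Sum>k<N-2. (real k + 1) * x ^ k)" for x :: real
  have "A_coeff N \<rho> p = - ((1 - \<rho>) * S p + \<rho> * S (1 - p)) / (real N - 1)"
    unfolding A_coeff_def S_def
  proof (rule extend_to_endpoints_eq)
    show "A_formula N \<rho> x = - ((1 - \<rho>) * (\<Sum>k<N-2. (real k + 1) * x ^ k)
        + \<rho> * (\<Sum>k<N-2. (real k + 1) * (1 - x) ^ k)) / (real N - 1)"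
      if "x \<in> {0<..<1}" for x
      using assms(1) that by (rule A_formula_eq)
  qed (use assms in \<open>auto intro!: continuous_intros\<close>)
  moreover have "1 \<le> S p" "1 \<le> S (1 - p)"
    unfolding S_def using assms by (auto intro!: sum_Suc_times_power_ge_1)
  \<comment> \<open>A convex combination of values at least 1 is at least 1.\<close>
  then have "(1 - \<rho>) * 1 + \<rho> * 1 \<le> (1 - \<rho>) * S p + \<rho> * S (1 - p)"
    using assms by (intro add_mono mult_left_mono) auto
  ultimately show ?thesis
    using assms by (simp add: divide_neg_pos)
qed

lemma symmetric_nash_equilibrium_bilinear_iff:
  fixes a b c d :: real
  assumes a: "a < 0"
  shows "symmetric_nash_equilibrium
      (\<lambda>q1 q2. q1 * (a * q2 + b) + c * q2 + d) (\<lambda>q1 q2. q2 * (a * q1 + b) + c * q1 + d) s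
    \<longleftrightarrow> s = (max 0 (min 1 (- (b / a))), max 0 (min 1 (- (b / a))))"
proof -
  \<comment> \<open>Here \<open>g\<close> is the slope of the utility in the player's own strategy;
    the terms in \<open>c\<close> and \<open>d\<close> cancel when two own strategies are
    compared.\<close>
  have best_response: "(\<forall>x\<in>{0..1}. x * g \<le> q * g) \<longleftrightarrow> (g > 0 \<longrightarrow> q = 1) \<and> (g < 0 \<longrightarrow> q = 0)"
    if q: "q \<in> {0..1}" for q g :: real
  proof (intro iffI conjI impI ballI)
    assume *: "\<forall>x\<in>{0..1}. x * g \<le> q * g"
    show "q = 1" if "g > 0" using bspec[OF *, of 1] that q by auto
    show "q = 0" if "g < 0" using bspec[OF *, of 0] that q by (auto simp: zero_le_mult_iff)
  next
    fix x :: real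
    assume "(g > 0 \<longrightarrow> q = 1) \<and> (g < 0 \<longrightarrow> q = 0)" "x \<in> {0..1}"
    then show "x * g \<le> q * g"
      by (cases g "0::real" rule: linorder_cases) (auto simp: mult_le_0_iff)
  qed
  have fixed_point: "q \<in> {0..1} \<and> (a * q + b > 0 \<longrightarrow> q = 1) \<and> (a * q + b < 0 \<longrightarrow> q = 0)
      \<longleftrightarrow> q = max 0 (min 1 (- (b / a)))" for q
  proof -
    \<comment> \<open>Dividing by the negative \<open>a\<close> reverses the inequalities; for
      \<open>a > 0\<close> both corners could be fixed points.\<close>
    have slope: "a * q + b > 0 \<longleftrightarrow> q < - (b / a)" "a * q + b < 0 \<longleftrightarrow> q > - (b / a)"
      using a by (auto simp: field_simps)
    show ?thesis unfolding slope by (auto simp: max_def min_def)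
  qed
  obtain q1 q2 where "s = (q1, q2)" by fastforce
  then show ?thesis
    unfolding symmetric_nash_equilibrium_def nash_equilibrium_def
    \<comment> \<open>On the diagonal both players face the same slope, so one instance covers both
      conditions.\<close>
    using best_response[of q1 "a * q1 + b"] fixed_point[of q1]
    by (auto simp: not_less)
qed

theorem lemmaA2:
  fixes N :: nat and \<rho>\<^sub>2 p\<^sub>e\<^sub>q q\<^sub>e\<^sub>q :: real
  assumes "N \<ge> 3"
    and "\<rho>\<^sub>2 \<in> {0..1}"
    and "p\<^sub>e\<^sub>q \<in> {0..1}"
  defines "q\<^sub>e\<^sub>q \<equiv> max 0 (min 1 (- (B_coeff N \<rho>\<^sub>2 p\<^sub>e\<^sub>q / A_coeff N \<rho>\<^sub>2 p\<^sub>e\<^sub>q)))"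
  shows "A_coeff N \<rho>\<^sub>2 p\<^sub>e\<^sub>q \<noteq> 0
    \<and> (\<exists>!s. symmetric_nash_equilibrium (U1 N \<rho>\<^sub>2 p\<^sub>e\<^sub>q) (U2 N \<rho>\<^sub>2 p\<^sub>e\<^sub>q) s)
    \<and> symmetric_nash_equilibrium (U1 N \<rho>\<^sub>2 p\<^sub>e\<^sub>q) (U2 N \<rho>\<^sub>2 p\<^sub>e\<^sub>q) (q\<^sub>e\<^sub>q, q\<^sub>e\<^sub>q)"
proof -
  \<comment> \<open>This also makes the quotient in \<open>q\<^sub>e\<^sub>q\<close> a genuine one,
    not the default value of division by 0.\<close>
  have neg: "A_coeff N \<rho>\<^sub>2 p\<^sub>e\<^sub>q < 0" using assms by (intro A_coeff_neg)
  have "symmetric_nash_equilibrium (U1 N \<rho>\<^sub>2 p\<^sub>e\<^sub>q) (U2 N \<rho>\<^sub>2 p\<^sub>e\<^sub>q) s \<longleftrightarrow> s = (q\<^sub>e\<^sub>q, q\<^sub>e\<^sub>q)" for s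
    unfolding q\<^sub>e\<^sub>q_def U1_def[abs_def] U2_def[abs_def]
    by (rule symmetric_nash_equilibrium_bilinear_iff[OF neg])
  with neg show ?thesis by simp
qed

end
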